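(* Let $m\ge 1$ and let $\underline{r}=(r_1,\dots,r_m)$ be integers $r_i\ge 2$ that are pairwise coprime. For $n\ge 0$ let $CP_{\underline{r},n}$ be the set of partitions of $n$ none of whose parts is divisible by any of $r_1,\dots,r_m$. For a partition $\rho$ and $i\ge1$ let $m_i(\rho)$ be the multiplicity of $i$ as a part of $\rho$, and define for $j\ge 1$ $$V_{\underline{r},j,n}=\sum_{\rho\in CP_{\underline{r},n}} m_j(\rho),\qquad W_{\underline{r},j,n}=\sum_{\rho\in CP_{\underline{r},n}}\bigl|\{i\ge 1 \mid m_i(\rho)\ge j\}\bigr|.$$ If $j\ge 1$ is divisible by none of $r_1,\dots,r_m$, then $$V_{\underline{r},j,n}=\sum_{k_1,\dots,k_m\ge 0} W_{\underline{r},\,r_1^{k_1}r_2^{k_2}\cdots r_m^{k_m}j,\,n}.$$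
   Context: A partition is called $\underline{r}$-class regular if none of its parts is divisible by any $r_i$. *)

theory Defs
  imports "HOL-Analysis.Infinite_Sum" "HOL-Library.Multiset" "HOL-Library.FuncSet"
begin

definition partitions :: "nat \<Rightarrow> nat multiset set" where
  "partitions n = {\<rho>. 0 \<notin># \<rho> \<and> sum_mset \<rho> = n}"

text \<open>The family \<open>r\<^sub>1, \<dots>, r\<^sub>m\<close> is given by a function whose values outside \<open>{1..m}\<close> are
  irrelevant.\<close>

definition class_regular :: "nat \<Rightarrow> (nat \<Rightarrow> nat) \<Rightarrow> nat multiset \<Rightarrow> bool" where
  "class_regular m r \<rho> \<longleftrightarrow> (\<forall>p\<in>#\<rho>. \<forall>i\<in>{1..m}. \<not> r i dvd p)"

definition CP :: "nat \<Rightarrow> (nat \<Rightarrow> nat) \<Rightarrow> nat \<Rightarrow> nat multiset set" where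
  "CP m r n = {\<rho> \<in> partitions n. class_regular m r \<rho>}"

definition V :: "nat \<Rightarrow> (nat \<Rightarrow> nat) \<Rightarrow> nat \<Rightarrow> nat \<Rightarrow> nat" where
  "V m r j n = (\<Sum>\<rho>\<in>CP m r n. count \<rho> j)"

definition W :: "nat \<Rightarrow> (nat \<Rightarrow> nat) \<Rightarrow> nat \<Rightarrow> nat \<Rightarrow> nat" where
  "W m r j n = (\<Sum>\<rho>\<in>CP m r n. card {i. i \<ge> 1 \<and> count \<rho> i \<ge> j})"

text \<open>The sums and cardinalities above range over finite sets.\<close>

lemma finite_partitions: "finite (partitions n)"
proof (rule finite_subset)
  have size_le: "size \<rho> \<le> sum_mset \<rho>" if "0 \<notin># \<rho>" for \<rho> :: "nat multiset"
    using that by (induction \<rho>) auto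
  show "partitions n \<subseteq> mset ` {xs. set xs \<subseteq> {..n} \<and> length xs \<le> n}"
  proof
    fix \<rho> assume \<rho>: "\<rho> \<in> partitions n"
    obtain xs where xs: "mset xs = \<rho>" using ex_mset by blast
    have "p \<le> n" if "p \<in># \<rho>" for p
      using \<rho> that unfolding partitions_def by (auto dest!: multi_member_split)
    moreover have "size \<rho> \<le> n" using size_le \<rho> by (auto simp: partitions_def)
    ultimately show "\<rho> \<in> mset ` {xs. set xs \<subseteq> {..n} \<and> length xs \<le> n}"
      using xs by (auto intro!: image_eqI[where x = xs])
  qed
  show "finite (mset ` {xs. set xs \<subseteq> {..n} \<and> length xs \<le> n})"
    by (intro finite_imageI finite_lists_length_le) simp
qed

lemma finite_CP: "finite (CP m r n)"
  unfolding CP_def using finite_partitions by simp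

lemma finite_count_ge: "j \<ge> 1 \<Longrightarrow> finite {i. i \<ge> 1 \<and> count \<rho> i \<ge> j}"
  by (rule finite_subset[of _ "set_mset \<rho>"]) (auto simp: count_greater_zero_iff[symmetric] simp del: count_greater_zero_iff)

end

theory Submission
  imports Defs "HOL-Computational_Algebra.Factorial_Ring"
begin

text \<open>
  Call \<open>i \<ge> 1\<close> regular if no \<open>r\<^sub>l\<close> divides it. Removing \<open>c\<close> copies of a regular \<open>i\<close> shows that the
  partitions in \<open>CP\<close> of \<open>n\<close> containing \<open>i\<close> at least \<open>c\<close> times are equinumerous with \<open>CP\<close> of
  \<open>n - i * c\<close>, so their number \<open>g (i * c)\<close> depends on the product \<open>i * c\<close> only. Counting by levels,
  \<open>V\<^sub>j\<close> is the sum of \<open>g (j * t)\<close> over all \<open>t \<ge> 1\<close>, and \<open>W\<^sub>c\<close> is the sum of \<open>g (a * c)\<close> over all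
  regular \<open>a\<close>. By pairwise coprimality every \<open>t \<ge> 1\<close> is uniquely \<open>r\<^sub>1\<^bsup>k\<^sub>1\<^esup> \<cdots> r\<^sub>m\<^bsup>k\<^sub>m\<^esup> * a\<close> with \<open>a\<close>
  regular, where \<open>k\<^sub>l\<close> is the multiplicity of \<open>r\<^sub>l\<close> in \<open>t\<close>; regrouping the first sum gives the theorem.
\<close>

definition regular_parts :: "nat \<Rightarrow> (nat \<Rightarrow> nat) \<Rightarrow> nat set" where
  "regular_parts m r = {a. a \<ge> 1 \<and> (\<forall>i\<in>{1..m}. \<not> r i dvd a)}"

lemma CP_iff: "\<rho> \<in> CP m r n \<longleftrightarrow> set_mset \<rho> \<subseteq> regular_parts m r \<and> sum_mset \<rho> = n"
  by (auto simp: CP_def partitions_def class_regular_def regular_parts_def Suc_le_eq)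
    (metis gr0I)

lemma count_mult_le_sum_mset: "count \<rho> i * i \<le> sum_mset (\<rho> :: nat multiset)"
proof (induction \<rho>)
  case (add x \<rho>)
  then show ?case by (cases "x = i") auto
qed simp

text \<open>The case split guards against truncated subtraction: for \<open>i * c > n\<close> the
  difference \<open>n - i * c\<close> is 0, and \<open>CP m r 0\<close> contains the empty
  partition, which would be counted wrongly.\<close>

lemma card_CP_count_ge:
  assumes "i \<in> regular_parts m r"
  shows "card {\<rho> \<in> CP m r n. c \<le> count \<rho> i} = (if i * c \<le> n then card (CP m r (n - i * c)) else 0)"
proof (cases "i * c \<le> n")
  case True
  have "bij_betw (\<lambda>\<rho>. \<rho> + replicate_mset c i) (CP m r (n - i * c)) {\<rho> \<in> CP m r n. c \<le> count \<rho> i}"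
  proof (rule bij_betwI[where g = "\<lambda>\<rho>. \<rho> - replicate_mset c i"])
    show "(\<lambda>\<rho>. \<rho> + replicate_mset c i) \<in> CP m r (n - i * c) \<rightarrow> {\<rho> \<in> CP m r n. c \<le> count \<rho> i}"
      using assms True by (auto simp: CP_iff mult.commute split: if_splits)
    show "(\<lambda>\<rho>. \<rho> - replicate_mset c i) \<in> {\<rho> \<in> CP m r n. c \<le> count \<rho> i} \<rightarrow> CP m r (n - i * c)"
    proof
      fix \<rho> assume \<rho>: "\<rho> \<in> {\<rho> \<in> CP m r n. c \<le> count \<rho> i}"
      then have "sum_mset \<rho> = sum_mset (\<rho> - replicate_mset c i) + i * c"
        by (metis (no_types, lifting) count_le_replicate_mset_subset_eq mem_Collect_eq mult.commute
            of_nat_id subset_mset.diff_add sum_mset.union sum_mset_replicate_mset)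
      then show "\<rho> - replicate_mset c i \<in> CP m r (n - i * c)"
        using \<rho> by (auto simp: CP_iff dest: in_diffD)
    qed
  qed (auto simp: count_le_replicate_mset_subset_eq)
  then show ?thesis
    using True by (simp add: bij_betw_same_card)
next
  case False
  have "{\<rho> \<in> CP m r n. c \<le> count \<rho> i} = {}"
  proof (intro equals0I)
    fix \<rho> assume "\<rho> \<in> {\<rho> \<in> CP m r n. c \<le> count \<rho> i}"
    then have "c * i \<le> count \<rho> i * i" "sum_mset \<rho> = n"
      by (auto simp: CP_iff)
    then have "c * i \<le> n"
      using count_mult_le_sum_mset[of \<rho> i] by linarith
    then show False
      using False by (simp add: mult.commute)
  qed
  then show ?thesis
    using False by (simp only: card.empty if_False)
qed

lemma sum_card_swap:
  assumes "finite A" "finite B"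
  shows "(\<Sum>x\<in>A. card {y \<in> B. P x y}) = (\<Sum>y\<in>B. card {x \<in> A. P x y})"
proof -
  have "(\<Sum>x\<in>A. card {y \<in> B. P x y}) = (\<Sum>x\<in>A. \<Sum>y\<in>B. if P x y then 1 else 0)"
    using assms by (simp add: sum.If_cases Int_def)
  also have "\<dots> = (\<Sum>y\<in>B. \<Sum>x\<in>A. if P x y then 1 else 0)"
    by (rule sum.swap)
  also have "\<dots> = (\<Sum>y\<in>B. card {x \<in> A. P x y})"
    using assms by (simp add: sum.If_cases Int_def)
  finally show ?thesis .
qed

text \<open>A multiplicity is the number of levels \<open>t \<ge> 1\<close> that it reaches; double
  counting then turns the sum over partitions into a sum over levels. Since
  \<open>t \<le> j * t\<close>, only the levels up to \<open>n\<close> contribute.\<close>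

lemma V_has_sum:
  assumes j: "j \<in> regular_parts m r"
  shows "((\<lambda>t. if j * t \<le> n then card (CP m r (n - j * t)) else 0) has_sum V m r j n) {1..}"
proof (rule has_sum_finite_neutralI[where B = "{1..n}"])
  have "j \<ge> 1"
    using j by (simp add: regular_parts_def)
  then have le: "t \<le> j * t" for t
    by simp
  show "(if j * t \<le> n then card (CP m r (n - j * t)) else 0) = 0" if "t \<in> {1..} - {1..n}" for t
    using that order_trans[OF le[of t], of n] by auto
  have "count \<rho> j = card {t \<in> {1..n}. t \<le> count \<rho> j}" if "\<rho> \<in> CP m r n" for \<rho>
  proof -
    have "count \<rho> j \<le> n"
      using that order_trans[OF le[of "count \<rho> j"], of n] count_mult_le_sum_mset[of \<rho> j]
      by (simp add: CP_iff mult.commute)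
    then have "{t \<in> {1..n}. t \<le> count \<rho> j} = {1..count \<rho> j}"
      by auto
    then show ?thesis by simp
  qed
  then have "V m r j n = (\<Sum>\<rho>\<in>CP m r n. card {t \<in> {1..n}. t \<le> count \<rho> j})"
    unfolding V_def by (rule sum.cong[OF refl])
  also have "\<dots> = (\<Sum>t\<in>{1..n}. card {\<rho> \<in> CP m r n. t \<le> count \<rho> j})"
    by (intro sum_card_swap finite_CP finite_atLeastAtMost)
  also have "\<dots> = (\<Sum>t\<in>{1..n}. if j * t \<le> n then card (CP m r (n - j * t)) else 0)"
    by (simp only: card_CP_count_ge[OF j])
  finally show "V m r j n = \<dots>" .
qed auto

lemma W_has_sum:
  assumes c: "c \<ge> 1"
  shows "((\<lambda>a. if a * c \<le> n then card (CP m r (n - a * c)) else 0) has_sum W m r c n)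
    (regular_parts m r)"
proof (rule has_sum_finite_neutralI[where B = "{1..n} \<inter> regular_parts m r"])
  have le: "a \<le> a * c" for a
    using c by simp
  show "(if a * c \<le> n then card (CP m r (n - a * c)) else 0) = 0"
    if "a \<in> regular_parts m r - {1..n} \<inter> regular_parts m r" for a
    using that order_trans[OF le[of a], of n] by (auto simp: regular_parts_def)
  have "{i. i \<ge> 1 \<and> count \<rho> i \<ge> c} = {i \<in> {1..n} \<inter> regular_parts m r. c \<le> count \<rho> i}"
    if "\<rho> \<in> CP m r n" for \<rho>
  proof -
    have "i \<in> {1..n} \<inter> regular_parts m r" if "count \<rho> i \<ge> c" "i \<ge> 1" for i
    proof -
      \<comment> \<open>Because \<open>c \<ge> 1\<close>, reaching level \<open>c\<close> makes
        \<open>i\<close> an actual part of \<open>\<rho>\<close>, hence regular and at most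
        \<open>n\<close>.\<close>
      have "count \<rho> i \<ge> 1"
        using c that by linarith
      then have "i \<le> count \<rho> i * i" "i \<in># \<rho>"
        by (simp, intro count_inI notI, simp)
      then show ?thesis
        using \<open>\<rho> \<in> CP m r n\<close> \<open>i \<ge> 1\<close> order_trans[OF _ count_mult_le_sum_mset[of \<rho> i], of i]
        by (auto simp: CP_iff)
    qed
    then show ?thesis by auto
  qed
  then have "W m r c n = (\<Sum>\<rho>\<in>CP m r n. card {i \<in> {1..n} \<inter> regular_parts m r. c \<le> count \<rho> i})"
    unfolding W_def by (intro sum.cong) simp_all
  also have "\<dots> = (\<Sum>i\<in>{1..n} \<inter> regular_parts m r. card {\<rho> \<in> CP m r n. c \<le> count \<rho> i})"
    by (intro sum_card_swap finite_CP finite_Int disjI1 finite_atLeastAtMost)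
  also have "\<dots> = (\<Sum>i\<in>{1..n} \<inter> regular_parts m r.
      if i * c \<le> n then card (CP m r (n - i * c)) else 0)"
    by (intro sum.cong refl card_CP_count_ge) simp
  finally show "W m r c n = \<dots>" .
qed auto

lemma prod_coprime_dvd:
  fixes f :: "'b \<Rightarrow> 'a :: semiring_gcd"
  assumes "finite I" "\<And>i. i \<in> I \<Longrightarrow> f i dvd t"
    and "\<And>i i'. i \<in> I \<Longrightarrow> i' \<in> I \<Longrightarrow> i \<noteq> i' \<Longrightarrow> coprime (f i) (f i')"
  shows "prod f I dvd t"
  using assms
proof (induction I rule: finite_induct)
  case (insert x F)
  have "coprime (f x) (prod f F)"
    using insert.hyps(2) insert.prems(2) by (intro prod_coprime_right) auto
  then show ?case
    using insert by (simp add: divides_mult)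
qed simp

text \<open>As \<open>r l\<close> may be composite, multiplicities need not add up over products.
  Coprimality replaces this: \<open>r l\<close> is coprime to the other powers, so dividing the
  cofactor would mean dividing \<open>a\<close>.\<close>

lemma multiplicity_prod_power_mult:
  fixes r :: "'b \<Rightarrow> 'a :: factorial_semiring_gcd"
  assumes "finite I" "l \<in> I"
    and cop: "\<And>i i'. i \<in> I \<Longrightarrow> i' \<in> I \<Longrightarrow> i \<noteq> i' \<Longrightarrow> coprime (r i) (r i')"
    and "r l \<noteq> 0" "\<not> r l dvd a"
  shows "multiplicity (r l) ((\<Prod>i\<in>I. r i ^ k i) * a) = k l"
proof (rule multiplicity_eqI)
  let ?q = "\<Prod>i\<in>I - {l}. r i ^ k i"
  have eq: "(\<Prod>i\<in>I. r i ^ k i) * a = r l ^ k l * (?q * a)"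
    using assms(1,2) by (simp add: prod.remove mult.assoc)
  then show "r l ^ k l dvd (\<Prod>i\<in>I. r i ^ k i) * a"
    by simp
  have "coprime (r l) ?q"
    using cop \<open>l \<in> I\<close> by (intro prod_coprime_right) auto
  then have "\<not> r l dvd ?q * a"
    using \<open>\<not> r l dvd a\<close> by (simp add: coprime_dvd_mult_right_iff)
  then show "\<not> r l ^ Suc (k l) dvd (\<Prod>i\<in>I. r i ^ k i) * a"
    using \<open>r l \<noteq> 0\<close> unfolding eq power_Suc2 by (subst dvd_times_left_cancel_iff) simp_all
qed

text \<open>Multiplicities recover the exponents, and cancellation then recovers \<open>a\<close>.
  Extensional functions make \<open>k\<close> determined by its values on
  \<open>{1..m}\<close>.\<close>

lemma bij_betw_prod_powers_times_regular:
  fixes r :: "nat \<Rightarrow> nat"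
  assumes r: "\<And>i. i \<in> {1..m} \<Longrightarrow> r i \<ge> 2"
    and cop: "\<And>i i'. i \<in> {1..m} \<Longrightarrow> i' \<in> {1..m} \<Longrightarrow> i \<noteq> i' \<Longrightarrow> coprime (r i) (r i')"
  shows "bij_betw (\<lambda>(k, a). (\<Prod>i\<in>{1..m}. r i ^ k i) * a)
    (({1..m} \<rightarrow>\<^sub>E UNIV) \<times> regular_parts m r) {1..}"
proof -
  let ?P = "\<lambda>k. \<Prod>i\<in>{1..m}. r i ^ k i"
  have pos: "?P k > 0" for k
    using r by (intro prod_pos) (force simp: zero_less_power)
  have mult: "multiplicity (r l) (?P k * a) = k l" if "a \<in> regular_parts m r" "l \<in> {1..m}" for a k l
    using that r[of l] cop by (intro multiplicity_prod_power_mult) (auto simp: regular_parts_def)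
  show ?thesis
    unfolding bij_betw_def
  proof (intro conjI inj_onI equalityI subsetI)
    fix x y
    assume "x \<in> ({1..m} \<rightarrow>\<^sub>E UNIV) \<times> regular_parts m r" "y \<in> ({1..m} \<rightarrow>\<^sub>E UNIV) \<times> regular_parts m r"
      and eq: "(case x of (k, a) \<Rightarrow> ?P k * a) = (case y of (k, a) \<Rightarrow> ?P k * a)"
    then obtain k a k' a' where xy: "x = (k, a)" "y = (k', a')"
      and k: "k \<in> {1..m} \<rightarrow>\<^sub>E UNIV" "k' \<in> {1..m} \<rightarrow>\<^sub>E UNIV"
      and a: "a \<in> regular_parts m r" "a' \<in> regular_parts m r"
      by blast
    have "k = k'"
      using k
    proof (rule PiE_ext)
      fix l assume "l \<in> {1..m}"
      then show "k l = k' l"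
        using mult[OF a(1), of l k] mult[OF a(2), of l k'] eq xy by simp
    qed
    then show "x = y"
      using eq xy nat_mult_eq_cancel1[OF pos[of k'], of a a'] by (simp only: prod.case)
  next
    fix t assume "t \<in> (\<lambda>(k, a). ?P k * a) ` (({1..m} \<rightarrow>\<^sub>E UNIV) \<times> regular_parts m r)"
    then obtain k a where "t = ?P k * a" "a \<in> regular_parts m r"
      by auto
    then show "t \<in> {1..}"
      using pos[of k] by (simp add: regular_parts_def Suc_le_eq)
  next
    fix t :: nat assume "t \<in> {1..}"
    then have t: "t \<noteq> 0"
      by auto
    \<comment> \<open>By \<open>mult\<close> this is the only possible choice of exponents.\<close>
    define k where "k = restrict (\<lambda>i. multiplicity (r i) t) {1..m}"
    have "?P k dvd t"
      using cop by (intro prod_coprime_dvd) (auto simp: k_def multiplicity_dvd)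
    then obtain a where a: "t = ?P k * a" ..
    \<comment> \<open>A factor \<open>r l\<close> left in \<open>a\<close> would raise the
      multiplicity of \<open>r l\<close> in \<open>t\<close> above \<open>k l\<close>.\<close>
    have "\<not> r l dvd a" if l: "l \<in> {1..m}" for l
    proof
      assume "r l dvd a"
      moreover have "r l ^ k l dvd ?P k"
        using l by (intro dvd_prodI) auto
      ultimately have "r l ^ Suc (multiplicity (r l) t) dvd t"
        using l by (subst (2) a) (simp only: power_Suc2 k_def restrict_apply' mult_dvd_mono)
      moreover have "\<not> is_unit (r l)"
        using r[OF l] by simp
      ultimately show False
        using t by (simp add: power_dvd_iff_le_multiplicity del: power_Suc)
    qed
    then have "a \<in> regular_parts m r"
      using a t by (auto simp: regular_parts_def Suc_le_eq)
    then show "t \<in> (\<lambda>(k, a). ?P k * a) ` (({1..m} \<rightarrow>\<^sub>E UNIV) \<times> regular_parts m r)"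
      using a by (intro image_eqI[where x = "(k, a)"]) (auto simp: k_def)
  qed
qed

lemma has_sum_nat_SigmaD:
  fixes f :: "'a \<times> 'b \<Rightarrow> nat"
  assumes "(f has_sum S) (Sigma A B)"
    and "\<And>x. x \<in> A \<Longrightarrow> ((\<lambda>y. f (x, y)) has_sum g x) (B x)"
  shows "(g has_sum S) A"
proof -
  \<comment> \<open>The detour through the reals supplies the type classes required by the library's Fubini rules.\<close>
  have "((\<lambda>x. real (g x)) has_sum real S) A"
    by (rule has_sum_Sigma'[where f = "\<lambda>x. real (f x)" and B = B])
      (intro has_sum_of_nat assms, assumption?)+
  then show ?thesis
    by (metis has_sum_imp_summable has_sum_infsum infsumI infsum_of_nat of_nat_eq_iff
        summable_on_of_nat_iff)
qed

theorem theorem2p1: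
  fixes m n j :: nat and r :: "nat \<Rightarrow> nat"
  assumes "m \<ge> 1"
    and "\<And>i. i \<in> {1..m} \<Longrightarrow> r i \<ge> 2"
    and "\<And>i i'. i \<in> {1..m} \<Longrightarrow> i' \<in> {1..m} \<Longrightarrow> i \<noteq> i' \<Longrightarrow> coprime (r i) (r i')"
    and "j \<ge> 1"
    and "\<And>i. i \<in> {1..m} \<Longrightarrow> \<not> r i dvd j"
  shows "((\<lambda>k. W m r ((\<Prod>i\<in>{1..m}. r i ^ k i) * j) n) has_sum V m r j n)
           ({1..m} \<rightarrow>\<^sub>E (UNIV :: nat set))"
\<comment> \<open>The series for \<open>V\<close> is summed over pairs \<open>(k, a)\<close> with
  \<open>t = ?P k * a\<close>; for fixed \<open>k\<close> the inner sum over regular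
  \<open>a\<close> is a value of \<open>W\<close>.\<close>
proof (rule has_sum_nat_SigmaD)
  let ?P = "\<lambda>k. \<Prod>i\<in>{1..m}. r i ^ k i"
  let ?g = "\<lambda>t. if j * t \<le> n then card (CP m r (n - j * t)) else 0"
  let ?f = "\<lambda>(k, a). ?P k * a"
  have bij: "bij_betw ?f (({1..m} \<rightarrow>\<^sub>E UNIV) \<times> regular_parts m r) {1..}"
    using assms(2,3) by (rule bij_betw_prod_powers_times_regular)
  have "(?g has_sum V m r j n) {1..}"
    using assms(4,5) by (intro V_has_sum) (simp add: regular_parts_def)
  then show "((\<lambda>x. ?g (?f x)) has_sum V m r j n) (({1..m} \<rightarrow>\<^sub>E UNIV) \<times> regular_parts m r)"
    by (simp only: has_sum_reindex_bij_betw[OF bij, where f = ?g])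
  fix k :: "nat \<Rightarrow> nat"
  have "?P k > 0"
    using assms(2) by (intro prod_pos) (force simp: zero_less_power)
  then have "?P k * j \<ge> 1"
    using assms(4) by (simp add: Suc_le_eq)
  note W_has_sum[OF this, of n m r]
  \<comment> \<open>The summand depends on the product only, so \<open>?P k\<close> can pass from
    the level \<open>t\<close> to the index of \<open>W\<close>.\<close>
  moreover have "j * ?f (k, a) = a * (?P k * j)" for a
    by (simp only: prod.case ac_simps)
  ultimately show "((\<lambda>a. ?g (?f (k, a))) has_sum W m r (?P k * j) n) (regular_parts m r)"
    by (simp only:)
qed

end
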